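(* For every finite lattice $L$ there exists a (finite) simplicial complex $\mathcal{H}$ such that $L$ is isomorphic to the lattice of flats $\mathrm{Fl}\,\mathcal{H}$.
   Context: A (finite) simplicial complex is a pair $\mathcal{H}=(V,H)$ where $V$ is a finite nonempty set and $H\subseteq 2^V$ is nonempty and closed under taking subsets. A subset $X\subseteq V$ is a flat of $\mathcal{H}$ if for every $I\in H$ with $I\subseteq X$ and every $p\in V\setminus X$ we have $I\cup\{p\}\in H$. The set $\mathrm{Fl}\,\mathcal{H}$ of all flats is closed under arbitrary intersections (with $V$ the empty intersection), and ordered by inclusion it is a lattice, called the lattice of flats of $\mathcal{H}$. *)

theory Defs
  imports "HOL-Algebra.Complete_Lattice"
begin

locale finite_simplicial_complex =
  fixes V :: "'v set" and H :: "'v set set"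
  assumes finite_vertices: "finite V"
    and vertices_nonempty: "V \<noteq> {}"
    and faces_subset: "H \<subseteq> Pow V"
    and faces_nonempty: "H \<noteq> {}"
    and faces_down_closed: "I \<in> H \<Longrightarrow> J \<subseteq> I \<Longrightarrow> J \<in> H"

definition is_flat :: "'v set \<Rightarrow> 'v set set \<Rightarrow> 'v set \<Rightarrow> bool"
  where "is_flat V H X \<longleftrightarrow>
    X \<subseteq> V \<and> (\<forall>I\<in>H. I \<subseteq> X \<longrightarrow> (\<forall>p\<in>V - X. I \<union> {p} \<in> H))"

definition lattice_of_flats :: "'v set \<Rightarrow> 'v set set \<Rightarrow> 'v set gorder"
  where "lattice_of_flats V H = \<lparr>carrier = {X. is_flat V H X}, eq = (=), le = (\<subseteq>)\<rparr>"

text \<open>The predicates \<^const>\<open>join_pres\<close> and \<^const>\<open>meet_pres\<close> include the assertion that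
  both structures are lattices.\<close>

definition lattice_isomorphic ::
    "('a, 'c) gorder_scheme \<Rightarrow> ('b, 'd) gorder_scheme \<Rightarrow> bool"
  where "lattice_isomorphic L M \<longleftrightarrow>
    (\<exists>f. bij_betw f (carrier L) (carrier M) \<and> join_pres L M f \<and> meet_pres L M f)"

lemma is_flat_whole: "is_flat V H V"
  by (simp add: is_flat_def)

text \<open>Intersecting with \<open>V\<close> makes the empty intersection equal to \<open>V\<close>.\<close>

lemma is_flat_Inter:
  assumes "\<And>X. X \<in> \<F> \<Longrightarrow> is_flat V H X"
  shows "is_flat V H (V \<inter> \<Inter>\<F>)"
  using assms unfolding is_flat_def by blast

lemma lattice_lattice_of_flats: "lattice (lattice_of_flats V H)"
proof -
  let ?L = "lattice_of_flats V H"
  interpret partial_order ?L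
    by unfold_locales (auto simp: lattice_of_flats_def)
  show ?thesis
  proof unfold_locales
    fix X Y assume XY: "X \<in> carrier ?L" "Y \<in> carrier ?L"
    then have flats: "is_flat V H X" "is_flat V H Y"
      by (simp_all add: lattice_of_flats_def)
    let ?U = "{Z. is_flat V H Z \<and> X \<subseteq> Z \<and> Y \<subseteq> Z}"
    have "is_flat V H (V \<inter> \<Inter>?U)"
      by (rule is_flat_Inter) simp
    moreover have "X \<subseteq> V" "Y \<subseteq> V"
      using flats by (simp_all add: is_flat_def)
    ultimately have "least ?L (V \<inter> \<Inter>?U) (Upper ?L {X, Y})"
      using flats by (auto simp: least_def Upper_def lattice_of_flats_def)
    then show "\<exists>s. least ?L s (Upper ?L {X, Y})" ..
    have "is_flat V H (V \<inter> \<Inter>{X, Y})"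
      using flats by (intro is_flat_Inter) auto
    then have "greatest ?L (V \<inter> \<Inter>{X, Y}) (Lower ?L {X, Y})"
      using flats by (auto simp: greatest_def Lower_def lattice_of_flats_def is_flat_def)
    then show "\<exists>s. greatest ?L s (Lower ?L {X, Y})" ..
  qed
qed

end

(*
  Replace every element x of L by a star with centre (x, 0) and leaves (x, 1), ..., (x, 4).
  A set is a face iff it contains no vertex over the bottom element, no edge of a star, and no
  set C of 5 vertices such that C - below a is never a singleton, where below a consists of the
  vertices over the elements x <= a.  Each below a is a flat: adding a vertex outside below a to
  a face inside it creates no forbidden subset.  Conversely, in a flat the stars make the set a
  union of fibres, and forbidden 5-sets of the shapes {x, x, x, x, y} with y <= x and
  {x, x, y, y, z} with z = x \/ y make the set of underlying elements a nonempty ideal, which is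
  principal because L is finite.  The repetition of vertices is what guarantees that such a
  5-set meets the complement of any below a in no vertex or in at least two.
*)
theory Submission
  imports Defs
begin

section \<open>Order isomorphisms between lattices\<close>

lemma lattice_isomorphicI:
  assumes "lattice L" "lattice M"
    and bij: "bij_betw f (carrier L) (carrier M)"
    and le: "\<And>x y. x \<in> carrier L \<Longrightarrow> y \<in> carrier L \<Longrightarrow> f x \<sqsubseteq>\<^bsub>M\<^esub> f y \<longleftrightarrow> x \<sqsubseteq>\<^bsub>L\<^esub> y"
  shows "lattice_isomorphic L M"
proof -
  interpret L: lattice L by fact
  interpret M: lattice M by fact
  have f: "f x \<in> carrier M" if "x \<in> carrier L" for x
    using bij that by (auto simp: bij_betw_def)
  have surj: "\<exists>x\<in>carrier L. f x = y" if "y \<in> carrier M" for y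
    using bij that by (metis bij_betw_imp_surj_on imageE)
  have "f (x \<squnion>\<^bsub>L\<^esub> y) = f x \<squnion>\<^bsub>M\<^esub> f y" if xy: "x \<in> carrier L" "y \<in> carrier L" for x y
  proof (rule M.le_antisym)
    \<comment> \<open>The preimage \<open>z\<close> of the join in \<open>M\<close> is an upper
      bound of \<open>x\<close> and \<open>y\<close> because \<open>f\<close> reflects the order.
      The argument for meets is dual.\<close>
    obtain z where z: "z \<in> carrier L" "f z = f x \<squnion>\<^bsub>M\<^esub> f y"
      using surj f xy M.join_closed by metis
    have "x \<sqsubseteq>\<^bsub>L\<^esub> z" "y \<sqsubseteq>\<^bsub>L\<^esub> z"
      using le z xy f M.join_left M.join_right by metis+
    then have "x \<squnion>\<^bsub>L\<^esub> y \<sqsubseteq>\<^bsub>L\<^esub> z"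
      using L.join_le xy z by blast
    then show "f (x \<squnion>\<^bsub>L\<^esub> y) \<sqsubseteq>\<^bsub>M\<^esub> f x \<squnion>\<^bsub>M\<^esub> f y"
      using le z xy L.join_closed by metis
    show "f x \<squnion>\<^bsub>M\<^esub> f y \<sqsubseteq>\<^bsub>M\<^esub> f (x \<squnion>\<^bsub>L\<^esub> y)"
      by (rule M.join_le) (use xy le f in \<open>auto intro: L.join_left L.join_right\<close>)
  qed (use xy f in auto)
  moreover have "f (x \<sqinter>\<^bsub>L\<^esub> y) = f x \<sqinter>\<^bsub>M\<^esub> f y" if xy: "x \<in> carrier L" "y \<in> carrier L" for x y
  proof (rule M.le_antisym)
    obtain z where z: "z \<in> carrier L" "f z = f x \<sqinter>\<^bsub>M\<^esub> f y"
      using surj f xy M.meet_closed by metis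
    have "z \<sqsubseteq>\<^bsub>L\<^esub> x" "z \<sqsubseteq>\<^bsub>L\<^esub> y"
      using le z xy f M.meet_left M.meet_right by metis+
    then have "z \<sqsubseteq>\<^bsub>L\<^esub> x \<sqinter>\<^bsub>L\<^esub> y"
      using L.meet_le xy z by blast
    then show "f x \<sqinter>\<^bsub>M\<^esub> f y \<sqsubseteq>\<^bsub>M\<^esub> f (x \<sqinter>\<^bsub>L\<^esub> y)"
      using le z xy L.meet_closed by metis
    show "f (x \<sqinter>\<^bsub>L\<^esub> y) \<sqsubseteq>\<^bsub>M\<^esub> f x \<sqinter>\<^bsub>M\<^esub> f y"
      by (rule M.meet_le) (use xy le f in \<open>auto intro: L.meet_left L.meet_right\<close>)
  qed (use xy f in auto)
  ultimately show ?thesis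
    using bij assms(1,2) by (auto simp: lattice_isomorphic_def join_pres_def meet_pres_def)
qed

section \<open>Renaming the vertices of a complex\<close>

lemma image_subset_image_iff:
  assumes "inj_on f C" "A \<subseteq> C" "B \<subseteq> C"
  shows "f ` A \<subseteq> f ` B \<longleftrightarrow> A \<subseteq> B"
  using assms unfolding inj_on_def by blast

lemma finite_simplicial_complex_image:
  assumes "finite_simplicial_complex V H"
  shows "finite_simplicial_complex (e ` V) ((`) e ` H)"
proof -
  interpret finite_simplicial_complex V H by fact
  show ?thesis
  proof
    fix I J assume "I \<in> (`) e ` H" "J \<subseteq> I"
    then obtain K where "K \<in> H" "J \<subseteq> e ` K" by auto
    then obtain K' where "K' \<subseteq> K" "J = e ` K'" by (auto simp: subset_image_iff)
    then show "J \<in> (`) e ` H" using faces_down_closed \<open>K \<in> H\<close> by auto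
  qed (use finite_vertices vertices_nonempty faces_subset faces_nonempty in auto)
qed

text \<open>Injectivity on \<open>V\<close> lets inclusion, complement and membership in
  \<open>H\<close> be read off from images, so that flats survive the later passage to natural
  numbers.\<close>

lemma is_flat_image:
  assumes inj: "inj_on e V" and H: "H \<subseteq> Pow V" and X: "X \<subseteq> V"
  shows "is_flat (e ` V) ((`) e ` H) (e ` X) \<longleftrightarrow> is_flat V H X"
proof -
  have sub: "e ` I \<subseteq> e ` X \<longleftrightarrow> I \<subseteq> X" if "I \<subseteq> V" for I
    using image_subset_image_iff[OF inj that X] .
  have faces: "e ` J \<in> (`) e ` H \<longleftrightarrow> J \<in> H" if "J \<subseteq> V" for J
    using inj H that by (auto simp: inj_on_image_eq_iff)
  have diff: "e ` V - e ` X = e ` (V - X)"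
    using inj X by (simp add: inj_on_image_set_diff)
  have "insert (e p) (e ` I) \<in> (`) e ` H \<longleftrightarrow> insert p I \<in> H" if "I \<in> H" "p \<in> V" for I p
    using faces[of "insert p I"] H that by auto
  moreover have "I \<subseteq> V" if "I \<in> H" for I
    using H that by auto
  ultimately show ?thesis
    using X by (simp add: is_flat_def diff sub image_mono)
qed

section \<open>The complex attached to a lattice and its obvious flats\<close>

context lattice
begin

text \<open>Each fibre has a centre and as many leaves as the 5-set with a fourfold \<open>x\<close>
  uses up.\<close>

definition vertices :: "('a \<times> nat) set"
  where "vertices = carrier L \<times> {..4}"

definition below :: "'a \<Rightarrow> ('a \<times> nat) set"
  where "below a = {v \<in> vertices. fst v \<sqsubseteq> a}"

text \<open>The clause with \<open>y\<close> excludes vertices over the bottom without naming it.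
  The last clause describes what happens when a vertex outside \<open>below a\<close> joins a face
  inside it: exactly one vertex of \<open>C\<close> sticks out.\<close>

definition faces :: "('a \<times> nat) set set"
  where "faces = {I. I \<subseteq> vertices
    \<and> (\<forall>v\<in>I. \<exists>y\<in>carrier L. \<not> fst v \<sqsubseteq> y)
    \<and> (\<forall>x i. (x, 0) \<in> I \<longrightarrow> (x, i) \<in> I \<longrightarrow> i = 0)
    \<and> (\<forall>C\<subseteq>I. card C = 5 \<longrightarrow> (\<exists>a\<in>carrier L. \<exists>v. C - below a = {v}))}"

lemma finite_simplicial_complex_faces:
  assumes "finite (carrier L)" "carrier L \<noteq> {}"
  shows "finite_simplicial_complex vertices faces"
proof
  show "finite vertices" "vertices \<noteq> {}" "faces \<subseteq> Pow vertices"
    using assms by (auto simp: vertices_def faces_def)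
  have "{} \<in> faces" by (auto simp: faces_def)
  then show "faces \<noteq> {}" by blast
  \<comment> \<open>Every clause is universal over vertices or subsets of \<open>I\<close>, hence
    inherited by \<open>J\<close>.\<close>
  show "J \<in> faces" if "I \<in> faces" "J \<subseteq> I" for I J
    using that unfolding faces_def mem_Collect_eq by (meson subset_trans subsetD)
qed

text \<open>With fewer than five vertices there is no \<open>C\<close> to test.\<close>

lemma facesI_small:
  assumes "I \<subseteq> vertices" "\<And>v. v \<in> I \<Longrightarrow> \<exists>y\<in>carrier L. \<not> fst v \<sqsubseteq> y"
    and "\<And>x i. (x, 0) \<in> I \<Longrightarrow> (x, i) \<in> I \<Longrightarrow> i = 0"
    and "finite I" "card I < 5"
  shows "I \<in> faces"
proof -
  have "card C \<noteq> 5" if "C \<subseteq> I" for C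
    using card_mono[OF assms(4) that] assms(5) by simp
  with assms show ?thesis by (auto simp: faces_def)
qed

lemma is_flat_below:
  assumes a: "a \<in> carrier L"
  shows "is_flat vertices faces (below a)"
  unfolding is_flat_def
proof (intro conjI ballI impI)
  fix I p assume I: "I \<in> faces" "I \<subseteq> below a" and p: "p \<in> vertices - below a"
  \<comment> \<open>If \<open>p\<close> is in \<open>C\<close>, all its other vertices come from
    \<open>I\<close> and so lie in \<open>below a\<close>; the given \<open>a\<close> is the
    witness.\<close>
  have "\<exists>a\<in>carrier L. \<exists>v. C - below a = {v}" if C: "C \<subseteq> I \<union> {p}" "card C = 5" for C
  proof (cases "p \<in> C")
    case True
    with C I p have "C - below a = {p}" by auto
    with a show ?thesis by blast
  next
    case False
    with C I show ?thesis by (auto simp: faces_def)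
  qed
  \<comment> \<open>A star edge containing \<open>p\<close> has its other end outside
    \<open>below a\<close> too, since \<open>below a\<close> is a union of fibres.\<close>
  moreover have "i = 0" if "(x, 0) \<in> I \<union> {p}" "(x, i) \<in> I \<union> {p}" for x i
  proof (cases "(x, 0) = p \<or> (x, i) = p")
    case True
    moreover have "(x, 0) \<notin> I" if "(x, i) = p"
      using that I(2) p by (auto simp: below_def vertices_def)
    moreover have "(x, i) \<notin> I" if "(x, 0) = p"
      using that I(2) p by (auto simp: below_def vertices_def)
    ultimately show ?thesis using that by auto
  next
    case False
    with that have "(x, 0) \<in> I" "(x, i) \<in> I" by auto
    with I(1) show ?thesis unfolding faces_def by blast
  qed
  moreover have "\<exists>y\<in>carrier L. \<not> fst v \<sqsubseteq> y" if "v \<in> I \<union> {p}" for v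
    using that I p a by (auto simp: faces_def below_def)
  moreover have "I \<union> {p} \<subseteq> vertices" using I p by (auto simp: below_def)
  ultimately show "I \<union> {p} \<in> faces" by (simp add: faces_def)
qed (auto simp: below_def)

section \<open>Recovering a lattice element from a flat\<close>

lemma finite_ideal_principal:
  assumes "finite A" "A \<subseteq> carrier L" "A \<noteq> {}"
    and down: "\<And>x y. x \<in> A \<Longrightarrow> y \<in> carrier L \<Longrightarrow> y \<sqsubseteq> x \<Longrightarrow> y \<in> A"
    and join: "\<And>x y. x \<in> A \<Longrightarrow> y \<in> A \<Longrightarrow> x \<squnion> y \<in> A"
  shows "\<exists>a\<in>carrier L. A = {x \<in> carrier L. x \<sqsubseteq> a}"
proof -
  \<comment> \<open>Finite subsets of \<open>A\<close> have upper bounds inside \<open>A\<close>;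
    for \<open>B = A\<close> this yields a greatest element.\<close>
  have "\<exists>a\<in>A. \<forall>b\<in>B. b \<sqsubseteq> a" if "finite B" "B \<subseteq> A" for B
    using that
  proof (induction B rule: finite_induct)
    case empty
    with assms show ?case by auto
  next
    case (insert b B)
    then obtain a where a: "a \<in> A" "\<forall>c\<in>B. c \<sqsubseteq> a" by auto
    with insert assms(2) have ab: "a \<in> carrier L" "b \<in> carrier L" "B \<subseteq> carrier L" by auto
    have "\<forall>c\<in>insert b B. c \<sqsubseteq> b \<squnion> a"
      using a ab join_left join_right join_closed by (auto intro: le_trans[of _ a "b \<squnion> a"])
    with join insert a show ?case by auto
  qed
  from this[of A] obtain a where "a \<in> A" "\<forall>b\<in>A. b \<sqsubseteq> a" using assms(1) by auto
  with assms(2) down[of a] show ?thesis by (intro bexI[of _ a]) auto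
qed

lemma flat_eq_below:
  assumes fin: "finite (carrier L)" and ne: "carrier L \<noteq> {}"
    and flat: "is_flat vertices faces X"
  shows "\<exists>a\<in>carrier L. X = below a"
proof -
  have XV: "X \<subseteq> vertices"
    and step: "\<And>I p. I \<in> faces \<Longrightarrow> I \<subseteq> X \<Longrightarrow> p \<in> vertices \<Longrightarrow> p \<notin> X \<Longrightarrow> insert p I \<in> faces"
    using flat by (auto simp: is_flat_def)
  \<comment> \<open>The empty face lies in every flat, so a vertex outside \<open>X\<close> forms a
    face by itself.\<close>
  have nonbot: "\<exists>y\<in>carrier L. \<not> x \<sqsubseteq> y" if "x \<in> carrier L" "i \<le> 4" "(x, i) \<notin> X" for x i
    using step[of "{}" "(x, i)"] that by (auto simp: faces_def vertices_def)
  \<comment> \<open>A star edge leaving \<open>X\<close> would become a face, as an extension of the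
    singleton of its end in \<open>X\<close>.\<close>
  have edge: "(x, j) \<in> X"
    if ij: "(x, i) \<in> X" "j \<le> 4" "i = 0 \<or> j = 0" for x and i j :: nat
  proof (rule ccontr)
    assume nX: "(x, j) \<notin> X"
    have x: "x \<in> carrier L" "i \<le> 4" using ij XV by (auto simp: vertices_def)
    have "{(x, i)} \<in> faces"
      using nonbot[OF x(1) ij(2) nX] x by (intro facesI_small) (auto simp: vertices_def)
    then have "{(x, j), (x, i)} \<in> faces"
      using step[of "{(x, i)}" "(x, j)"] nX ij x by (auto simp: vertices_def)
    with ij have "i = j" by (auto simp: faces_def)
    with nX ij show False by simp
  qed
  define A where "A = {x \<in> carrier L. (x, 0) \<in> X}"
  \<comment> \<open>Leaves are connected through the centre, so \<open>X\<close> contains all of a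
    fibre or none of it.\<close>
  have X_iff: "(x, i) \<in> X \<longleftrightarrow> x \<in> A \<and> i \<le> 4" for x i
    using XV edge[of x i 0] edge[of x 0 i] by (auto simp: A_def vertices_def)
  \<comment> \<open>\<open>I\<close> consists of leaves only, so it has no star edge and is a face
    inside \<open>X\<close>. Adding \<open>(z, 1)\<close> gives a face with five vertices, which is
    then itself an admissible \<open>C\<close>.\<close>
  have A_step: "\<exists>a\<in>carrier L. \<exists>v. insert (z, 1) I - below a = {v}"
    if I: "I \<subseteq> A \<times> {1..4}" "card I = 4" and z: "z \<in> carrier L" "z \<notin> A"
      and "\<And>x. x \<in> fst ` I \<Longrightarrow> \<exists>y\<in>carrier L. \<not> x \<sqsubseteq> y" for I z
  proof -
    have finI: "finite I" using I(2) by (simp add: card_ge_0_finite)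
    have "I \<subseteq> vertices" using I(1) by (auto simp: A_def vertices_def)
    moreover have "(x, 0) \<notin> I" for x using I(1) by auto
    ultimately have "I \<in> faces" using that finI by (intro facesI_small) auto
    moreover have "I \<subseteq> X" using I(1) X_iff by auto
    moreover have "(z, 1) \<in> vertices" "(z, 1) \<notin> X" using z X_iff by (auto simp: vertices_def)
    ultimately have "insert (z, 1) I \<in> faces" using step by blast
    moreover have "card (insert (z, 1) I) = 5" using finI I z by (subst card_insert_disjoint) auto
    ultimately show ?thesis by (auto simp: faces_def)
  qed
  \<comment> \<open>Otherwise both copies of \<open>u\<close> would stick out of
    \<open>below a\<close>.\<close>
  have le_if_two_vertices: "u \<sqsubseteq> a"
    if "C - below a = {v}" "(u, 1) \<in> C" "(u, 2) \<in> C" for u a v C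
  proof (rule ccontr)
    assume "\<not> u \<sqsubseteq> a"
    then have "(u, 1) \<in> C - below a" "(u, 2) \<in> C - below a" using that by (auto simp: below_def)
    then show False unfolding that(1) by auto
  qed
  have "\<exists>a\<in>carrier L. A = {x \<in> carrier L. x \<sqsubseteq> a}"
  proof (rule finite_ideal_principal)
    show "finite A" "A \<subseteq> carrier L" using fin by (auto simp: A_def)
    \<comment> \<open>The bottom \<open>b\<close> is the infimum of the whole carrier; by
      \<open>nonbot\<close>, its vertices cannot be missing from \<open>X\<close>.\<close>
    obtain b where b: "b \<in> carrier L" "\<forall>y\<in>carrier L. b \<sqsubseteq> y"
      using finite_inf_greatest[OF fin order_refl ne] by (auto simp: greatest_def Lower_def)
    then have "b \<in> A" using nonbot[of b 0] by (auto simp: A_def)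
    then show "A \<noteq> {}" by blast
  next
    fix x y assume x: "x \<in> A" and y: "y \<in> carrier L" "y \<sqsubseteq> x"
    show "y \<in> A"
    proof (rule ccontr)
      assume yA: "y \<notin> A"
      have xL: "x \<in> carrier L" using x by (simp add: A_def)
      \<comment> \<open>Being outside \<open>A\<close>, \<open>y\<close> is not the bottom, hence
        neither is \<open>x\<close> above it.\<close>
      have "\<exists>w\<in>carrier L. \<not> y \<sqsubseteq> w" using nonbot[of y 0] y(1) yA by (auto simp: A_def)
      then have "\<exists>w\<in>carrier L. \<not> x \<sqsubseteq> w" using y xL le_trans by blast
      then obtain a v where a: "a \<in> carrier L"
        and v: "insert (y, 1) ({x} \<times> {1..4}) - below a = {v}"
        using A_step[of "{x} \<times> {1..4}" y] x y(1) yA by auto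
      have xa: "x \<sqsubseteq> a" by (rule le_if_two_vertices[OF v]) auto
      \<comment> \<open>Now the whole 5-set lies in \<open>below a\<close>, so nothing is left for
        \<open>v\<close>.\<close>
      then have "y \<sqsubseteq> a" using y a xL le_trans by blast
      with xa xL y(1) have "insert (y, 1) ({x} \<times> {1..4}) \<subseteq> below a"
        by (auto simp: below_def vertices_def)
      with v show False by auto
    qed
  next
    fix x y assume x: "x \<in> A" and y: "y \<in> A"
    have xL: "x \<in> carrier L" "y \<in> carrier L" using x y by (simp_all add: A_def)
    show "x \<squnion> y \<in> A"
    proof (rule ccontr)
      assume zA: "x \<squnion> y \<notin> A"
      \<comment> \<open>If \<open>x\<close> and \<open>y\<close> were comparable, their join would
        be one of them and lie in \<open>A\<close>. Incomparability makes them distinct, giving four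
        leaves, and different from the bottom.\<close>
      have "\<not> x \<sqsubseteq> y" using zA y xL by (auto simp: le_iff_meet)
      moreover have "\<not> y \<sqsubseteq> x" using zA x xL join_comm[of L x y] by (auto simp: le_iff_meet)
      ultimately have neq: "x \<noteq> y"
        and nb: "\<exists>w\<in>carrier L. \<not> x \<sqsubseteq> w" "\<exists>w\<in>carrier L. \<not> y \<sqsubseteq> w" using xL by auto
      have "\<exists>a\<in>carrier L. \<exists>v. insert (x \<squnion> y, 1) ({x, y} \<times> {1..2}) - below a = {v}"
      proof (rule A_step)
        show "card ({x, y} \<times> {1..2::nat}) = 4" using neq by (simp add: card_cartesian_product)
      qed (use x y zA xL nb in auto)
      then obtain a v where a: "a \<in> carrier L"
        and v: "insert (x \<squnion> y, 1) ({x, y} \<times> {1..2}) - below a = {v}" by blast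
      have xa: "x \<sqsubseteq> a" by (rule le_if_two_vertices[OF v]) auto
      have ya: "y \<sqsubseteq> a" by (rule le_if_two_vertices[OF v]) auto
      have "x \<squnion> y \<sqsubseteq> a" using join_le xa ya xL a by blast
      with xa ya xL have "insert (x \<squnion> y, 1) ({x, y} \<times> {1..2}) \<subseteq> below a"
        by (auto simp: below_def vertices_def)
      with v show False by auto
    qed
  qed
  then obtain a where a: "a \<in> carrier L" "A = {x \<in> carrier L. x \<sqsubseteq> a}" by blast
  then have "X = below a"
    using X_iff by (auto simp: below_def vertices_def)
  with a show ?thesis by blast
qed

lemma below_subset_iff:
  assumes "a \<in> carrier L" "b \<in> carrier L"
  shows "below a \<subseteq> below b \<longleftrightarrow> a \<sqsubseteq> b"
proof
  assume "below a \<subseteq> below b"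
  moreover have "(a, 0) \<in> below a" using assms by (auto simp: below_def vertices_def)
  ultimately show "a \<sqsubseteq> b" by (auto simp: below_def)
next
  assume "a \<sqsubseteq> b"
  with assms show "below a \<subseteq> below b"
    by (auto simp: below_def vertices_def intro: le_trans)
qed

end

theorem theorem3p1:
  fixes L :: "('a, 'b) gorder_scheme"
  assumes "lattice L"
    and "finite (carrier L)"
    and "carrier L \<noteq> {}"
  shows "\<exists>(V :: nat set) H.
    finite_simplicial_complex V H \<and> lattice_isomorphic L (lattice_of_flats V H)"
proof -
  interpret lattice L by fact
  interpret complex: finite_simplicial_complex vertices faces
    using assms(2,3) by (rule finite_simplicial_complex_faces)
  \<comment> \<open>The complex built so far has vertices in \<open>'a \<times> nat\<close>;
    \<open>e\<close> encodes them as natural numbers.\<close>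
  obtain e :: "'a \<times> nat \<Rightarrow> nat" where e: "inj_on e vertices"
    using finite_imp_inj_to_nat_seg complex.finite_vertices by blast
  define V where "V = e ` vertices"
  define H where "H = (`) e ` faces"
  define f where "f = (\<lambda>a. e ` below a)"
  have below_V: "below a \<subseteq> vertices" for a by (auto simp: below_def)
  have f_le: "f a \<subseteq> f b \<longleftrightarrow> a \<sqsubseteq>\<^bsub>L\<^esub> b" if "a \<in> carrier L" "b \<in> carrier L" for a b
    using that e below_V by (simp add: f_def image_subset_image_iff below_subset_iff)
  have f_flat: "is_flat V H (f a)" if "a \<in> carrier L" for a
    unfolding V_def H_def f_def
    using is_flat_image[OF e complex.faces_subset below_V] is_flat_below[OF that] by simp
  have "\<exists>a\<in>carrier L. Y = f a" if Y: "is_flat V H Y" for Y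
  proof -
    from Y obtain X where X: "X \<subseteq> vertices" "Y = e ` X"
      by (auto simp: is_flat_def V_def subset_image_iff)
    with Y have "is_flat vertices faces X"
      using is_flat_image[OF e complex.faces_subset X(1)] by (simp add: V_def H_def)
    with flat_eq_below[OF assms(2,3)] X(2) show ?thesis unfolding f_def by blast
  qed
  moreover have "inj_on f (carrier L)"
    using f_le le_antisym by (intro inj_onI) (metis subset_refl)
  ultimately have "bij_betw f (carrier L) (carrier (lattice_of_flats V H))"
    using f_flat by (auto simp: bij_betw_def lattice_of_flats_def)
  then have "lattice_isomorphic L (lattice_of_flats V H)"
    using assms(1) lattice_lattice_of_flats f_le
    by (intro lattice_isomorphicI) (simp_all add: lattice_of_flats_def)
  moreover have "finite_simplicial_complex V H"
    unfolding V_def H_def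
    by (rule finite_simplicial_complex_image) (rule complex.finite_simplicial_complex_axioms)
  ultimately show ?thesis by blast
qed

end
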